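(* If $G$ is a graph of order $n \ge 2$, then $2 \le c_{\min}(G) \le n$. Moreover, these bounds are sharp, i.e., there exist graphs $G$ of order $n\ge 2$ attaining the lower bound $c_{\min}(G)=2$, and graphs $G$ of order $n \ge 2$ attaining the upper bound $c_{\min}(G)=n$.
   Context: Graphs are finite, simple and undirected, with nonempty vertex set; the order of $G$ is $|V(G)|$. A set $S\subseteq V(G)$ is a dominating set of $G$ if every vertex of $V(G)\setminus S$ is adjacent to a vertex of $S$. All parts of a partition are nonempty. Two disjoint sets $X,Y\subseteq V(G)$ form a coalition in $G$ if neither $X$ nor $Y$ is a dominating set of $G$ but $X\cup Y$ is a dominating set of $G$. A $c$-partition of $G$ is a partition $\{V_1,\ldots,V_k\}$ of $V(G)$ such that each $V_i$ either is a dominating set consisting of a single vertex, or forms a coalition with some other set $V_j$ ($j\neq i$) of the partition. For partitions $\mathcal{A},\mathcal{B}$ of $V(G)$, $\mathcal{B}$ is a refinement of $\mathcal{A}$ if every set of $\mathcal{B}$ is equal to or a proper subset of some set of $\mathcal{A}$; it is a proper refinement if moreover $\mathcal{A}\ne\mathcal{B}$. A $c$-partition is minimal if it is not a proper refinement of any other $c$-partition of $G$. The minmin coalition number $c_{\min}(G)$ is the minimum number of sets in a minimal $c$-partition of $G$. *)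

theory Defs
  imports "HOL-Library.Disjoint_Sets" "Graph_Theory.Pair_Digraph"
begin

text \<open>
  A finite simple undirected graph is an instance of the locale \<open>pair_graph\<close>: a finite
  vertex set with a symmetric, irreflexive arc relation, so that \<open>(u, v) \<in> parcs G\<close> is
  adjacency. That locale admits the empty vertex set, which has to be excluded separately.
\<close>

definition order :: "'a pair_pre_digraph \<Rightarrow> nat" where
  "order G = card (pverts G)"

definition dominating_set :: "'a pair_pre_digraph \<Rightarrow> 'a set \<Rightarrow> bool" where
  "dominating_set G S \<longleftrightarrow>
     S \<subseteq> pverts G \<and> (\<forall>v \<in> pverts G - S. \<exists>u \<in> S. (u, v) \<in> parcs G)"

definition coalition :: "'a pair_pre_digraph \<Rightarrow> 'a set \<Rightarrow> 'a set \<Rightarrow> bool" where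
  "coalition G X Y \<longleftrightarrow>
     X \<subseteq> pverts G \<and> Y \<subseteq> pverts G \<and> X \<inter> Y = {} \<and>
     \<not> dominating_set G X \<and> \<not> dominating_set G Y \<and> dominating_set G (X \<union> Y)"

definition c_partition :: "'a pair_pre_digraph \<Rightarrow> 'a set set \<Rightarrow> bool" where
  "c_partition G P \<longleftrightarrow>
     partition_on (pverts G) P \<and>
     (\<forall>X \<in> P. (dominating_set G X \<and> (\<exists>v. X = {v})) \<or> (\<exists>Y \<in> P. Y \<noteq> X \<and> coalition G X Y))"

definition minimal_c_partition :: "'a pair_pre_digraph \<Rightarrow> 'a set set \<Rightarrow> bool" where
  "minimal_c_partition G P \<longleftrightarrow>
     c_partition G P \<and> (\<forall>Q. c_partition G Q \<and> Q \<noteq> P \<longrightarrow> \<not> refines (pverts G) P Q)"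

text \<open>
  The infimum of a nonempty set of natural numbers is its minimum. For a graph without
  minimal c-partitions the value would be \<open>0\<close>, so a positive lower bound on \<open>c_min\<close>
  includes the claim that minimal c-partitions exist.
\<close>

definition c_min :: "'a pair_pre_digraph \<Rightarrow> nat" where
  "c_min G = Inf {card P | P. minimal_c_partition G P}"

end

theory Submission
  imports Defs
begin

text \<open>
  The upper bound is the trivial bound on the number of blocks of a partition, and the lower
  bound holds because the one-block partition of two or more vertices is not a c-partition. The
  substance is that a minimal c-partition exists at all, so that \<open>c_min\<close> is a true
  minimum and not the infimum of the empty set.

  The key idea is to forget about partners. Every block of a c-partition is
  a dominating singleton or a non-dominating set; call a partition with this weaker property
  \<^emph>\<open>admissible\<close>. Admissible partitions exist trivially: cut the vertex set into
  singletons. An admissible partition with as few blocks as possible is automatically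
  a c-partition (\<open>fewest_blocks_imp_c_partition\<close>): two non-dominating blocks whose union is
  non-dominating could be merged, so any two non-dominating blocks form a coalition, and a
  non-dominating block cannot be alone among dominating singletons. As no c-partition has
  fewer blocks and a proper coarsening always has fewer blocks, it is a minimal c-partition.

  Sharpness needs one graph only: for order 2 the two bounds coincide.
\<close>

section \<open>Partitions of finite sets\<close>

lemma card_partition_on_le:
  assumes "finite A" "partition_on A P"
  shows "card P \<le> card A"
proof -
  have "\<exists>x. x \<in> X" if "X \<in> P" for X
    using that partition_onD3[OF assms(2)] by (metis all_not_in_conv)
  then obtain r where r: "r X \<in> X" if "X \<in> P" for X
    by metis
  show ?thesis
  proof (rule card_inj_on_le[of r])
    show "inj_on r P"
      using partition_onD2[OF assms(2)] r by (intro inj_onI) (metis disjointD disjoint_iff)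
    show "r ` P \<subseteq> A"
      using r partition_onD1[OF assms(2)] by auto
  qed (rule assms(1))
qed

lemma partition_on_eq_block:
  assumes "partition_on A P" "X \<in> P" "Y \<in> P" "x \<in> X" "x \<in> Y"
  shows "X = Y"
  using assms unfolding partition_on_def disjoint_def by blast

text \<open>
  Sending each block of the finer partition to the block that contains it is a surjection. If
  the coarser partition has at least as many blocks, then it is also injective, so
  no block of the coarser partition is cut.
\<close>

lemma refines_card_le_imp_eq:
  assumes "finite A" and ref: "refines A P Q" and le: "card P \<le> card Q"
  shows "P = Q"
proof -
  have P: "partition_on A P" and Q: "partition_on A Q"
    using ref by (auto simp: refines_def)
  obtain f where f: "f X \<in> Q" "X \<subseteq> f X" if "X \<in> P" for X
    using ref unfolding refines_def by metis
  have surj: "f ` P = Q"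
  proof
    show "Q \<subseteq> f ` P"
    proof
      fix Y assume Y: "Y \<in> Q"
      then obtain y where y: "y \<in> Y"
        using partition_onD3[OF Q] by fastforce
      then obtain X where X: "X \<in> P" "y \<in> X"
        using Y partition_onD1[OF P] partition_onD1[OF Q] by blast
      then have "f X = Y"
        using partition_on_eq_block[OF Q _ Y _ y] f by blast
      then show "Y \<in> f ` P"
        using X by auto
    qed
  qed (use f in auto)
  have finP: "finite P"
    using finite_elements[OF assms(1) P] .
  then have "inj_on f P"
    using le surj card_image_le[OF finP, of f] by (intro eq_card_imp_inj_on) auto
  have "f X = X" if X: "X \<in> P" for X
  proof
    show "f X \<subseteq> X"
    proof
      fix x assume x: "x \<in> f X"
      then obtain X' where X': "X' \<in> P" "x \<in> X'"
        using f(1)[OF X] partition_onD1[OF P] partition_onD1[OF Q] by blast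
      then have "f X' = f X"
        using partition_on_eq_block[OF Q _ _ _ x] f X by blast
      then show "x \<in> X"
        using \<open>inj_on f P\<close> X X' by (auto dest: inj_onD)
    qed
  qed (use f X in auto)
  then show ?thesis
    using surj by auto
qed

lemma partition_on_merge:
  assumes P: "partition_on A P" and X: "X \<in> P" and Y: "Y \<in> P"
  shows "partition_on A (insert (X \<union> Y) (P - {X, Y}))"
  using assms unfolding partition_on_def disjoint_def by (auto 4 4)

lemma card_merge_less:
  assumes "finite P" "X \<in> P" "Y \<in> P" "X \<noteq> Y"
  shows "card (insert (X \<union> Y) (P - {X, Y})) < card P"
proof -
  have "card (P - {X, Y}) + 2 = card P"
    using assms card_mono[of P "{X, Y}"] by (simp add: card_Diff_subset)
  then show ?thesis
    using card_insert_le_m1[of "card P - 1" "P - {X, Y}" "X \<union> Y"] by linarith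
qed

section \<open>Existence of minimal c-partitions\<close>

definition admissible_partition :: "'a pair_pre_digraph \<Rightarrow> 'a set set \<Rightarrow> bool" where
  "admissible_partition G P \<longleftrightarrow>
     partition_on (pverts G) P \<and> (\<forall>X \<in> P. dominating_set G X \<longrightarrow> (\<exists>v. X = {v}))"

lemma c_partition_imp_admissible:
  "c_partition G P \<Longrightarrow> admissible_partition G P"
  unfolding c_partition_def admissible_partition_def coalition_def by blast

lemma admissible_partition_singletons:
  "admissible_partition G ((\<lambda>v. {v}) ` pverts G)"
  unfolding admissible_partition_def by (auto intro: partition_on_singletons)

text \<open>
  A vertex that dominates on its own is, by symmetry of adjacency, dominated by every other
  vertex. So if all blocks but \<open>X\<close> are dominating singletons, each vertex outside
  \<open>X\<close> is adjacent to all of \<open>X\<close>, which makes \<open>X\<close> dominating.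
\<close>

lemma dominating_if_others_are_dominating_singletons:
  assumes G: "pair_graph G" and P: "partition_on (pverts G) P" and X: "X \<in> P"
    and others: "\<And>Y. Y \<in> P \<Longrightarrow> Y \<noteq> X \<Longrightarrow> dominating_set G Y \<and> (\<exists>v. Y = {v})"
  shows "dominating_set G X"
  unfolding dominating_set_def
proof (intro conjI ballI)
  show sub: "X \<subseteq> pverts G"
    using X partition_onD1[OF P] by auto
  fix v assume v: "v \<in> pverts G - X"
  obtain x where x: "x \<in> X"
    using X partition_onD3[OF P] by fastforce
  obtain Y where Y: "Y \<in> P" "v \<in> Y"
    using v partition_onD1[OF P] by blast
  then have "dominating_set G {v}"
    using others[of Y] v by auto
  then have "(v, x) \<in> parcs G"
    using x v sub unfolding dominating_set_def by auto
  then have "(x, v) \<in> parcs G"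
    using pair_sym_digraph.pair_sym_arcs[of G] G
    by (auto simp: pair_graph_def pair_pseudo_graph_def symmetric_def sym_def)
  then show "\<exists>u\<in>X. (u, v) \<in> parcs G"
    using x by blast
qed

text \<open>
  Minimality is spent on one comparison: merging two non-dominating blocks with a non-dominating
  union would stay admissible and save a block. So any other non-dominating block serves
  as a partner, and the previous lemma provides one.
\<close>

lemma fewest_blocks_imp_c_partition:
  assumes G: "pair_graph G" and P: "admissible_partition G P"
    and fewest: "\<And>Q. admissible_partition G Q \<Longrightarrow> card P \<le> card Q"
  shows "c_partition G P"
  unfolding c_partition_def
proof (intro conjI ballI)
  show part: "partition_on (pverts G) P"
    using P by (simp add: admissible_partition_def)
  have fin: "finite (pverts G)"
    using G by (simp add: pair_graph_def pair_digraph_def pair_fin_digraph.pair_finite_verts)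
  fix X assume X: "X \<in> P"
  show "dominating_set G X \<and> (\<exists>v. X = {v}) \<or> (\<exists>Y\<in>P. Y \<noteq> X \<and> coalition G X Y)"
  proof (cases "dominating_set G X")
    case True
    then show ?thesis
      using X P by (auto simp: admissible_partition_def)
  next
    case False
    then obtain Y where Y: "Y \<in> P" "Y \<noteq> X" "\<not> dominating_set G Y"
      using dominating_if_others_are_dominating_singletons[OF G part X] P
      unfolding admissible_partition_def by metis
    have "dominating_set G (X \<union> Y)"
    proof (rule ccontr)
      assume "\<not> dominating_set G (X \<union> Y)"
      then have "admissible_partition G (insert (X \<union> Y) (P - {X, Y}))"
        using P partition_on_merge[OF part X Y(1)] unfolding admissible_partition_def by auto
      then show False
        using fewest card_merge_less[OF finite_elements[OF fin part] X Y(1)] Y(2) by fastforce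
    qed
    moreover have "X \<inter> Y = {}"
      using partition_onD2[OF part] X Y by (auto dest: disjointD)
    ultimately have "coalition G X Y"
      using False X Y partition_onD1[OF part] unfolding coalition_def by blast
    then show ?thesis
      using Y by blast
  qed
qed

lemma minimal_c_partition_exists:
  assumes G: "pair_graph G"
  shows "\<exists>P. minimal_c_partition G P"
proof -
  obtain P where P: "admissible_partition G P"
    and fewest: "\<And>Q. admissible_partition G Q \<Longrightarrow> card P \<le> card Q"
    using ex_has_least_nat[of "admissible_partition G" _ card] admissible_partition_singletons
    by metis
  have fin: "finite (pverts G)"
    using G by (simp add: pair_graph_def pair_digraph_def pair_fin_digraph.pair_finite_verts)
  have "minimal_c_partition G P"
    unfolding minimal_c_partition_def
    using fewest_blocks_imp_c_partition[OF G P fewest] refines_card_le_imp_eq[OF fin, of P]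
      fewest[OF c_partition_imp_admissible] by blast
  then show ?thesis ..
qed

section \<open>Bounds on the minmin coalition number\<close>

lemma two_le_card_c_partition:
  assumes fin: "finite (pverts G)" and ord: "order G \<ge> 2" and P: "c_partition G P"
  shows "2 \<le> card P"
proof (rule ccontr)
  assume "\<not> 2 \<le> card P"
  have part: "partition_on (pverts G) P"
    using P by (simp add: c_partition_def)
  have "P \<noteq> {}"
    using ord partition_onD1[OF part] by (auto simp: order_def)
  then have "card P = 1"
    using \<open>\<not> 2 \<le> card P\<close> finite_elements[OF fin part]
    by (metis One_nat_def Suc_1 card_0_eq less_2_cases not_le)
  then obtain X where X: "P = {X}"
    by (auto simp: card_1_singleton_iff)
  \<comment> \<open>The only block has no partner, and with two or more vertices it is no singleton.\<close>
  then have "\<exists>v. pverts G = {v}"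
    using P partition_onD1[OF part] by (auto simp: c_partition_def)
  then show False
    using ord by (auto simp: order_def)
qed

lemma c_min_bounds:
  assumes G: "pair_graph G" and ord: "order G \<ge> 2"
  shows "2 \<le> c_min G \<and> c_min G \<le> order G"
proof -
  have fin: "finite (pverts G)"
    using G by (simp add: pair_graph_def pair_digraph_def pair_fin_digraph.pair_finite_verts)
  have "{card P | P. minimal_c_partition G P} \<noteq> {}"
    using minimal_c_partition_exists[OF G] by blast
  then have "c_min G \<in> {card P | P. minimal_c_partition G P}"
    unfolding c_min_def by (rule Inf_nat_def1)
  then obtain P where P: "c_min G = card P" "c_partition G P"
    by (auto simp: minimal_c_partition_def)
  then show ?thesis
    using two_le_card_c_partition[OF fin ord] card_partition_on_le[OF fin, of P]
    by (simp add: order_def c_partition_def)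
qed

theorem theorem1:
  shows "(\<forall>G :: 'a pair_pre_digraph.
            pair_graph G \<and> order G \<ge> 2 \<longrightarrow> 2 \<le> c_min G \<and> c_min G \<le> order G)
       \<and> (\<exists>G :: nat pair_pre_digraph. pair_graph G \<and> order G \<ge> 2 \<and> c_min G = 2)
       \<and> (\<exists>G :: nat pair_pre_digraph. pair_graph G \<and> order G \<ge> 2 \<and> c_min G = order G)"
proof -
  define K2 :: "nat pair_pre_digraph" where
    "K2 = \<lparr> pverts = {0, 1}, parcs = {(0, 1), (1, 0)} \<rparr>"
  have K2: "pair_graph K2"
    by unfold_locales (auto simp: K2_def symmetric_def sym_def)
  have "order K2 = 2"
    by (simp add: K2_def order_def)
  moreover from this have "c_min K2 = 2"
    using c_min_bounds[OF K2] by simp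
  ultimately show ?thesis
    using c_min_bounds K2 by (metis order_refl)
qed

end
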